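(* Let $\mathcal{A}$ be an alphabet and let $X\subseteq\Sigma_{\mathcal{A}}$ be a shift space. Then the following are equivalent: (i) $X$ is row-finite. (ii) $X^{\mathrm{fin}}\subseteq\{\vec{0}\}$. (iii) $X^{\mathrm{inf}}\cup\{\vec{0}\}$ is a closed subset of $\Sigma_{\mathcal{A}}$. (iv) Either $X=X^{\mathrm{inf}}\cup\{\vec{0}\}$ or $X$ is finite-symbol. (v) For each $a\in\mathcal{A}$, the set $\{b\in\mathcal{A}:\text{there exists }x\in X^{\mathrm{inf}}\text{ with }abx\in X\}$ is finite.
   Context: An alphabet is a set $\mathcal{A}$ (finite or infinite); $\mathbb{N}=\{1,2,3,\ldots\}$. Let $\mathcal{A}^0=\{\vec{0}\}$ ($\vec{0}$ the empty sequence), $\Sigma_{\mathcal{A}}^{\mathrm{fin}}=\bigcup_{k=0}^\infty\mathcal{A}^k$ and $\Sigma_{\mathcal{A}}^{\mathrm{inf}}=\mathcal{A}^{\mathbb{N}}$. Let $l(x)\in\{0,1,\ldots,\infty\}$ be the length of a sequence. The full shift $\Sigma_{\mathcal{A}}$: If $\mathcal{A}$ is infinite, $\Sigma_{\mathcal{A}}:=\Sigma_{\mathcal{A}}^{\mathrm{inf}}\sqcup\Sigma_{\mathcal{A}}^{\mathrm{fin}}$, topologized as follows. Let $\mathcal{A}_\infty=\mathcal{A}\cup\{\infty\}$ be the one-point compactification of the discrete space $\mathcal{A}$, let $X_{\mathcal{A}}=\mathcal{A}_\infty\times\mathcal{A}_\infty\times\cdots$ with the product topology, and let $Q:X_{\mathcal{A}}\to\Sigma_{\mathcal{A}}$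 truncate a sequence just before the first occurrence of $\infty$ (so $Q(x)=\vec{0}$ if $x_1=\infty$, and $Q(x)=x$ if $\infty$ does not occur); give $\Sigma_{\mathcal{A}}$ the quotient topology from $Q$. If $\mathcal{A}$ is finite, $\Sigma_{\mathcal{A}}:=\mathcal{A}^{\mathbb{N}}$ with the product topology, so it contains no finite sequences. The shift map $\sigma:\Sigma_{\mathcal{A}}\to\Sigma_{\mathcal{A}}$ deletes the first entry of a sequence, with $\sigma(x)=\vec{0}$ if $l(x)\le 1$. A subset $X\subseteq\Sigma_{\mathcal{A}}$ has the infinite-extension property if for every $x\in X$ with $l(x)<\infty$ the set $\{a\in\mathcal{A}: xay\in X\text{ for some }y\in\Sigma_{\mathcal{A}}\}$ is infinite ($xay$ denotes concatenation). A shift space over $\mathcal{A}$ is a subset $X\subseteq\Sigma_{\mathcal{A}}$ that is closed, satisfies $\sigma(X)\subseteq X$, and has the infinite-extension property (the empty set is allowed). Write $X^{\mathrm{inf}}=X\cap\Sigma_{\mathcal{A}}^{\mathrm{inf}}$ and $X^{\mathrm{fin}}=X\cap\Sigma_{\mathcal{A}}^{\mathrm{fin}}$. $B(X)\subseteq\Sigma_{\mathcal{A}}^{\mathrm{fin}}$ is the set of all finite blocks $u$ that occur as a subblock of some element of $X$ (i.e. some element of $X$ has the form $yuz$), and $B_1(X)=B(X)\cap\mathcal{A}^1$. The shift space $X$ is finite-symbol if $B_1(X)$ is finite, and row-finite if for every $a\in\mathcal{A}$ the set $\{b\in\mathcal{A}:ab\in B(X)\}$ is finite.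
   Formalization: In (iii) the set X^inf ∪ {0} is intersected with Σ_A before asking whether it is closed; for finite alphabets Σ_A lacks the empty sequence, so (iii) as written would always fail there, while for infinite alphabets nothing changes. *)

theory Defs
  imports "HOL-Analysis.Analysis"
begin

text \<open>Sequences are indexed from 0 rather than from 1; \<open>FinSeq []\<close> is the empty sequence.\<close>

datatype 'a sequence = FinSeq "'a list" | InfSeq "nat \<Rightarrow> 'a"

definition fin_seqs :: "'a set \<Rightarrow> 'a sequence set" where
  "fin_seqs A = {FinSeq u | u. set u \<subseteq> A}"

definition inf_seqs :: "'a set \<Rightarrow> 'a sequence set" where
  "inf_seqs A = {InfSeq f | f. range f \<subseteq> A}"

text \<open>For finite \<open>A\<close> the empty sequence is not a point of the full shift, so a set such as
  \<open>inf_part A X \<union> {FinSeq []}\<close> (see below) must be intersected with \<open>full_shift A\<close> before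
  asking whether it is closed there.\<close>

definition full_shift :: "'a set \<Rightarrow> 'a sequence set" where
  "full_shift A = (if finite A then inf_seqs A else inf_seqs A \<union> fin_seqs A)"

fun prepend :: "'a list \<Rightarrow> 'a sequence \<Rightarrow> 'a sequence" where
  "prepend u (FinSeq v) = FinSeq (u @ v)"
| "prepend u (InfSeq f) = InfSeq (\<lambda>n. if n < length u then u ! n else f (n - length u))"

text \<open>As \<open>tl [] = []\<close>, sequences of length at most 1 are sent to the empty sequence.\<close>

fun shift_map :: "'a sequence \<Rightarrow> 'a sequence" where
  "shift_map (FinSeq u) = FinSeq (tl u)"
| "shift_map (InfSeq f) = InfSeq (\<lambda>n. f (Suc n))"

definition quotient_topology :: "'a topology \<Rightarrow> ('a \<Rightarrow> 'b) \<Rightarrow> 'b topology" where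
  "quotient_topology T f =
     topology (\<lambda>U. U \<subseteq> f ` topspace T \<and> openin T {x \<in> topspace T. f x \<in> U})"

lemma openin_quotient_topology:
  "openin (quotient_topology T f) U \<longleftrightarrow>
     U \<subseteq> f ` topspace T \<and> openin T {x \<in> topspace T. f x \<in> U}"
proof -
  have "istopology (\<lambda>U. U \<subseteq> f ` topspace T \<and> openin T {x \<in> topspace T. f x \<in> U})"
  proof (unfold istopology_def, intro conjI allI impI; (elim conjE)?)
    fix S U
    assume "openin T {x \<in> topspace T. f x \<in> S}" "openin T {x \<in> topspace T. f x \<in> U}"
    then have "openin T ({x \<in> topspace T. f x \<in> S} \<inter> {x \<in> topspace T. f x \<in> U})"
      by blast
    moreover have "{x \<in> topspace T. f x \<in> S} \<inter> {x \<in> topspace T. f x \<in> U}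
        = {x \<in> topspace T. f x \<in> S \<inter> U}" by blast
    ultimately show "openin T {x \<in> topspace T. f x \<in> S \<inter> U}" by simp
  next
    fix \<K>
    assume *: "\<forall>K\<in>\<K>. K \<subseteq> f ` topspace T \<and> openin T {x \<in> topspace T. f x \<in> K}"
    then have "openin T (\<Union>K\<in>\<K>. {x \<in> topspace T. f x \<in> K})" by blast
    moreover have "(\<Union>K\<in>\<K>. {x \<in> topspace T. f x \<in> K}) = {x \<in> topspace T. f x \<in> \<Union>\<K>}"
      by blast
    ultimately show "openin T {x \<in> topspace T. f x \<in> \<Union>\<K>}" by simp
    show "\<Union>\<K> \<subseteq> f ` topspace T" using * by blast
  qed blast
  then show ?thesis
    by (simp add: quotient_topology_def topology_inverse')
qed

lemma topspace_quotient_topology [simp]: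
  "topspace (quotient_topology T f) = f ` topspace T"
proof
  show "topspace (quotient_topology T f) \<subseteq> f ` topspace T"
    by (metis openin_quotient_topology openin_topspace)
  have "{x \<in> topspace T. f x \<in> f ` topspace T} = topspace T" by blast
  then have "openin (quotient_topology T f) (f ` topspace T)"
    by (simp add: openin_quotient_topology)
  then show "f ` topspace T \<subseteq> topspace (quotient_topology T f)"
    by (rule openin_subset)
qed

lemma quotient_map_quotient_topology: "quotient_map T (quotient_topology T f) f"
  by (auto simp: quotient_map_def openin_quotient_topology)

text \<open>In \<^const>\<open>Alexandroff_compactification\<close> the point at infinity is \<^const>\<open>None\<close>.\<close>

definition compactified_product :: "'a set \<Rightarrow> (nat \<Rightarrow> 'a option) topology" where
  "compactified_product A =
     product_topology (\<lambda>_. Alexandroff_compactification (discrete_topology A)) UNIV"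

definition truncate_seq :: "(nat \<Rightarrow> 'a option) \<Rightarrow> 'a sequence" where
  "truncate_seq x =
     (if \<exists>n. x n = None
      then FinSeq (map (\<lambda>i. the (x i)) [0..<(LEAST n. x n = None)])
      else InfSeq (\<lambda>n. the (x n)))"

text \<open>For finite \<open>A\<close> the product topology is merely transported along the injective
  constructor \<^const>\<open>InfSeq\<close>, see \<open>homeomorphic_map_InfSeq\<close> below.\<close>

definition full_shift_topology :: "'a set \<Rightarrow> 'a sequence topology" where
  "full_shift_topology A =
     (if finite A
      then quotient_topology (product_topology (\<lambda>_. discrete_topology A) UNIV) InfSeq
      else quotient_topology (compactified_product A) truncate_seq)"

lemma homeomorphic_map_InfSeq:
  assumes "finite A"
  shows "homeomorphic_map (product_topology (\<lambda>_. discrete_topology A) UNIV)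
           (full_shift_topology A) InfSeq"
  using assms
  by (simp add: homeomorphic_map_def full_shift_topology_def quotient_map_quotient_topology
      inj_on_def)

lemma truncate_seq_image:
  "truncate_seq ` topspace (compactified_product A) = inf_seqs A \<union> fin_seqs A"
proof (intro equalityI subsetI)
  fix s assume "s \<in> truncate_seq ` topspace (compactified_product A)"
  then obtain x where x: "\<And>n. x n \<in> insert None (Some ` A)" and s: "s = truncate_seq x"
    unfolding compactified_product_def by (fastforce simp: PiE_iff)
  have mem: "the (x n) \<in> A" if "x n \<noteq> None" for n
    using x[of n] that by auto
  show "s \<in> inf_seqs A \<union> fin_seqs A"
  proof (cases "\<exists>n. x n = None")
    case True
    have "the (x i) \<in> A" if "i < (LEAST n. x n = None)" for i
      using not_less_Least[OF that] mem by blast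
    then show ?thesis
      using True by (auto simp: s truncate_seq_def fin_seqs_def)
  next
    case False
    then have "truncate_seq x = InfSeq (\<lambda>n. the (x n))" "\<And>n. the (x n) \<in> A"
      using mem by (auto simp: truncate_seq_def)
    then show ?thesis
      by (auto simp: s inf_seqs_def)
  qed
next
  fix s assume "s \<in> inf_seqs A \<union> fin_seqs A"
  then consider f where "s = InfSeq f" "range f \<subseteq> A" | u where "s = FinSeq u" "set u \<subseteq> A"
    by (auto simp: inf_seqs_def fin_seqs_def)
  then show "s \<in> truncate_seq ` topspace (compactified_product A)"
  proof cases
    case 1
    then show ?thesis
      by (intro image_eqI[where x = "\<lambda>n. Some (f n)"])
         (auto simp: truncate_seq_def compactified_product_def PiE_iff)
  next
    case 2
    define x where "x n = (if n < length u then Some (u ! n) else None)" for n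
    have "(LEAST n. x n = None) = length u"
      by (rule Least_equality) (auto simp: x_def split: if_splits)
    then have "truncate_seq x = s"
      using 2 by (auto simp: truncate_seq_def x_def intro!: nth_equalityI)
    moreover have "x \<in> topspace (compactified_product A)"
      using 2 nth_mem by (fastforce simp: x_def compactified_product_def PiE_iff)
    ultimately show ?thesis by blast
  qed
qed

lemma topspace_full_shift_topology: "topspace (full_shift_topology A) = full_shift A"
proof (cases "finite A")
  case True
  then show ?thesis
    by (auto simp: full_shift_topology_def full_shift_def inf_seqs_def PiE_iff image_iff)
next
  case False
  then show ?thesis
    by (simp add: full_shift_topology_def full_shift_def truncate_seq_image)
qed

definition infinite_extension :: "'a set \<Rightarrow> 'a sequence set \<Rightarrow> bool" where
  "infinite_extension A X \<longleftrightarrow>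
     (\<forall>u. FinSeq u \<in> X \<longrightarrow> infinite {a \<in> A. \<exists>y \<in> full_shift A. prepend (u @ [a]) y \<in> X})"

definition shift_space :: "'a set \<Rightarrow> 'a sequence set \<Rightarrow> bool" where
  "shift_space A X \<longleftrightarrow>
     X \<subseteq> full_shift A \<and> closedin (full_shift_topology A) X \<and>
     shift_map ` X \<subseteq> X \<and> infinite_extension A X"

definition inf_part :: "'a set \<Rightarrow> 'a sequence set \<Rightarrow> 'a sequence set" where
  "inf_part A X = X \<inter> inf_seqs A"

definition fin_part :: "'a set \<Rightarrow> 'a sequence set \<Rightarrow> 'a sequence set" where
  "fin_part A X = X \<inter> fin_seqs A"

definition blocks :: "'a sequence set \<Rightarrow> 'a list set" where
  "blocks X = {u. \<exists>y z. prepend (y @ u) z \<in> X}"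

definition finite_symbol :: "'a sequence set \<Rightarrow> bool" where
  "finite_symbol X \<longleftrightarrow> finite {u \<in> blocks X. length u = 1}"

definition row_finite :: "'a set \<Rightarrow> 'a sequence set \<Rightarrow> bool" where
  "row_finite A X \<longleftrightarrow> (\<forall>a\<in>A. finite {b \<in> A. [a, b] \<in> blocks X})"

end

theory Submission
  imports Defs
begin

text \<open>Everything is compared with the condition that \<open>X\<close> contains no nonempty finite sequence.
  Two limit principles do the work over an infinite alphabet. If infinitely many letters can
  follow the finite word \<open>u\<close> in a closed set, then by compactness of the product \<open>u\<close> itself lies
  in the set; and an infinite sequence lies in a closed set as soon as all its prefixes extend to
  elements of the set. By the infinite-extension property, the second principle lets every finite
  element of \<open>X\<close> be extended to an infinite one, with infinitely many choices for the next letter.\<close>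

section \<open>Canonical preimages of sequences under truncation\<close>

fun lift_seq :: "'a sequence \<Rightarrow> nat \<Rightarrow> 'a option" where
  "lift_seq (FinSeq u) = (\<lambda>n. if n < length u then Some (u ! n) else None)"
| "lift_seq (InfSeq f) = (\<lambda>n. Some (f n))"

text \<open>Nothing is assumed about \<open>x\<close> beyond the first \<open>None\<close>: the
  points to which this is applied come from a compactness argument that leaves the tail
  unknown.\<close>

lemma truncate_seq_eq_FinSeq:
  assumes "\<And>i. i < length u \<Longrightarrow> x i = Some (u ! i)" "x (length u) = None"
  shows "truncate_seq x = FinSeq u"
proof -
  have "(LEAST n. x n = None) = length u"
    by (rule Least_equality) (use assms in \<open>auto simp: not_less[symmetric]\<close>)
  then show ?thesis
    using assms by (auto simp: truncate_seq_def intro!: nth_equalityI)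
qed

lemma truncate_lift_seq: "truncate_seq (lift_seq s) = s"
proof (cases s)
  case (FinSeq u)
  then show ?thesis by (auto intro: truncate_seq_eq_FinSeq)
next
  case (InfSeq f)
  then show ?thesis by (simp add: truncate_seq_def)
qed

lemma lift_seq_in_topspace:
  assumes "s \<in> full_shift A"
  shows "lift_seq s \<in> topspace (compactified_product A)"
  using assms nth_mem
  by (cases s) (fastforce simp: full_shift_def inf_seqs_def fin_seqs_def
      compactified_product_def PiE_iff split: if_splits)+

lemma lift_seq_prepend: "i < length u \<Longrightarrow> lift_seq (prepend u y) i = Some (u ! i)"
  by (cases y) (auto simp: nth_append)

lemma prepend_append: "prepend (u @ v) y = prepend u (prepend v y)"
  by (cases y) (auto simp: nth_append fun_eq_iff)

lemma prepend_in_full_shiftD: "prepend u y \<in> full_shift A \<Longrightarrow> set u \<subseteq> A"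
proof
  fix a assume *: "prepend u y \<in> full_shift A" "a \<in> set u"
  then obtain i where i: "i < length u" "a = u ! i" by (auto simp: in_set_conv_nth)
  have "lift_seq (prepend u y) i \<in> insert None (Some ` A)"
    using lift_seq_in_topspace[OF *(1)] by (auto simp: compactified_product_def PiE_iff)
  then show "a \<in> A" using i by (auto simp: lift_seq_prepend)
qed

section \<open>Closed and compact sets in the compactified product\<close>

text \<open>For infinite \<open>A\<close>, \<open>truncate_seq\<close> is a quotient map, so
  questions of closedness can be moved to the product, where compactness and coordinate projections
  are available.\<close>

lemma closedin_full_shift_iff:
  assumes "infinite A" "X \<subseteq> full_shift A"
  shows "closedin (full_shift_topology A) X \<longleftrightarrow>
    closedin (compactified_product A) {x \<in> topspace (compactified_product A). truncate_seq x \<in> X}"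
proof -
  have "quotient_map (compactified_product A) (full_shift_topology A) truncate_seq"
    using assms(1) by (simp add: full_shift_topology_def quotient_map_quotient_topology)
  then show ?thesis
    using assms(2) by (simp add: quotient_map_closedin topspace_full_shift_topology)
qed

lemma continuous_map_coordinate:
  "continuous_map (compactified_product A) (Alexandroff_compactification (discrete_topology A))
     (\<lambda>x. x i)"
  unfolding compactified_product_def by (rule continuous_map_product_projection) simp

lemma compact_space_compactified_product: "compact_space (compactified_product A)"
  by (simp add: compactified_product_def compact_space_product_topology)

lemma Hausdorff_space_compactified_alphabet:
  "Hausdorff_space (Alexandroff_compactification (discrete_topology A))"
  by (simp add: Hausdorff_space_Alexandroff_compactification
      locally_compact_space_discrete_topology)

lemma closedin_coordinate_eq:
  assumes "c \<in> insert None (Some ` A)"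
  shows "closedin (compactified_product A) {x \<in> topspace (compactified_product A). x i = c}"
proof -
  have "closedin (Alexandroff_compactification (discrete_topology A)) {c}"
    using assms by (intro closedin_Hausdorff_singleton[OF Hausdorff_space_compactified_alphabet]) auto
  from closedin_continuous_map_preimage[OF continuous_map_coordinate this] show ?thesis
    by simp
qed

text \<open>Compact sets are closed in this Hausdorff space, and a closed set avoiding
  \<open>None\<close> is the \<open>Some\<close>-image of a compact, hence finite, set of
  letters.\<close>

lemma compactin_compactified_alphabet_None:
  assumes "compactin (Alexandroff_compactification (discrete_topology A)) K"
    and "infinite {a. Some a \<in> K}"
  shows "None \<in> K"
proof (rule ccontr)
  assume "None \<notin> K"
  have "closedin (Alexandroff_compactification (discrete_topology A)) K"
    using assms(1) Hausdorff_space_compactified_alphabet by (rule compactin_imp_closedin[rotated])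
  moreover have "K = Some ` {a. Some a \<in> K}"
    using \<open>None \<notin> K\<close> by (auto simp: image_iff) (metis not_None_eq)
  ultimately have "compactin (discrete_topology A) {a. Some a \<in> K}"
    using \<open>None \<notin> K\<close>
    by (auto simp: closedin_Alexandroff_compactification inj_image_eq_iff)
  then show False
    using assms(2) by (simp add: compactin_discrete_topology)
qed

section \<open>The two limit principles\<close>

text \<open>The preimage of \<open>X\<close>, restricted to points starting with \<open>u\<close>,
  is compact, and so is its projection to the next coordinate. That projection contains infinitely
  many letters, hence also \<open>None\<close>; a point with this coordinate truncates to
  \<open>u\<close>.\<close>

lemma closed_FinSeq_limit:
  assumes "infinite A" and cl: "closedin (full_shift_topology A) X"
    and inf: "infinite {a. \<exists>y. prepend (u @ [a]) y \<in> X}"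
  shows "FinSeq u \<in> X"
proof -
  have sub: "X \<subseteq> full_shift A"
    using closedin_subset[OF cl] by (simp add: topspace_full_shift_topology)
  let ?T = "compactified_product A"
  let ?F = "\<lambda>i. {x \<in> topspace ?T. x i = Some (u ! i)}"
  let ?C = "{x \<in> topspace ?T. truncate_seq x \<in> X}"
  define D where "D = {x \<in> ?C. \<forall>i<length u. x i = Some (u ! i)}"
  \<comment> \<open>A single extension already shows that the letters of \<open>u\<close> lie in
    \<open>A\<close>, as closedness of the sets \<open>?F i\<close> requires.\<close>
  obtain a y where "prepend (u @ [a]) y \<in> X"
    using inf not_finite_existsD by blast
  then have "set u \<subseteq> A"
    using prepend_in_full_shiftD sub by fastforce
  have "closedin ?T ?C"
    using cl closedin_full_shift_iff[OF assms(1) sub] by blast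
  moreover have "closedin ?T (?F i)" if "i < length u" for i
    using that \<open>set u \<subseteq> A\<close> nth_mem by (intro closedin_coordinate_eq) blast
  ultimately have "closedin ?T (\<Inter>(insert ?C (?F ` {..<length u})))"
    by (intro closedin_Inter) auto
  also have "\<Inter>(insert ?C (?F ` {..<length u})) = D"
    by (auto simp: D_def)
  finally have "compactin ?T D"
    by (rule closedin_compact_space[OF compact_space_compactified_product])
  then have "compactin (Alexandroff_compactification (discrete_topology A))
      ((\<lambda>x. x (length u)) ` D)"
    using continuous_map_coordinate by (rule image_compactin)
  moreover have "{a. \<exists>y. prepend (u @ [a]) y \<in> X} \<subseteq> {a. Some a \<in> (\<lambda>x. x (length u)) ` D}"
  proof clarify
    fix a y assume *: "prepend (u @ [a]) y \<in> X"
    let ?x = "lift_seq (prepend (u @ [a]) y)"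
    have "?x \<in> D"
      using * sub
      by (auto simp: D_def lift_seq_in_topspace truncate_lift_seq lift_seq_prepend nth_append)
    moreover have "?x (length u) = Some a"
      by (simp add: lift_seq_prepend)
    ultimately show "Some a \<in> (\<lambda>x. x (length u)) ` D"
      by (metis image_eqI)
  qed
  ultimately have "None \<in> (\<lambda>x. x (length u)) ` D"
    using compactin_compactified_alphabet_None inf infinite_super by blast
  then obtain x where x: "x \<in> D" "x (length u) = None"
    by fastforce
  then have "truncate_seq x = FinSeq u"
    by (intro truncate_seq_eq_FinSeq) (auto simp: D_def)
  then show ?thesis
    using x by (simp add: D_def)
qed

text \<open>A basic neighbourhood of the lifted sequence constrains finitely many coordinates only,
  so it contains the lift of any element that shares a long enough prefix.\<close>

lemma closed_InfSeq_limit: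
  assumes "infinite A" and cl: "closedin (full_shift_topology A) X"
    and prefix: "\<And>n. \<exists>y. prepend (map f [0..<n]) y \<in> X"
  shows "InfSeq f \<in> X"
proof (rule ccontr)
  assume "InfSeq f \<notin> X"
  have sub: "X \<subseteq> full_shift A"
    using closedin_subset[OF cl] by (simp add: topspace_full_shift_topology)
  have "f n \<in> A" for n
    using prefix[of "Suc n"] prepend_in_full_shiftD sub by fastforce
  then have "InfSeq f \<in> full_shift A"
    by (auto simp: full_shift_def inf_seqs_def)
  let ?T = "compactified_product A"
  let ?V = "topspace ?T - {x \<in> topspace ?T. truncate_seq x \<in> X}"
  have "openin ?T ?V"
    using cl closedin_full_shift_iff[OF assms(1) sub] by blast
  moreover have "lift_seq (InfSeq f) \<in> ?V"
    using \<open>InfSeq f \<notin> X\<close> \<open>InfSeq f \<in> full_shift A\<close>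
    by (auto simp del: lift_seq.simps simp: truncate_lift_seq lift_seq_in_topspace)
  ultimately have "\<exists>U. 
        finite {i \<in> UNIV. U i \<noteq> topspace (Alexandroff_compactification (discrete_topology A))}
      \<and> (\<forall>i\<in>UNIV. openin (Alexandroff_compactification (discrete_topology A)) (U i))
      \<and> lift_seq (InfSeq f) \<in> Pi\<^sub>E UNIV U \<and> Pi\<^sub>E UNIV U \<subseteq> ?V"
    unfolding compactified_product_def openin_product_topology_alt by (rule bspec)
  then obtain U where
    fin: "finite {i. U i \<noteq> topspace (Alexandroff_compactification (discrete_topology A))}"
    and U: "lift_seq (InfSeq f) \<in> Pi\<^sub>E UNIV U" "Pi\<^sub>E UNIV U \<subseteq> ?V"
    by auto
  \<comment> \<open>All constrained coordinates lie below \<open>n\<close>, so agreement on the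
    first \<open>n\<close> letters is enough to enter the box.\<close>
  from finite_nat_bounded[OF fin] obtain n where
    n: "{i. U i \<noteq> topspace (Alexandroff_compactification (discrete_topology A))} \<subseteq> {..<n}"
    by blast
  obtain y where y: "prepend (map f [0..<n]) y \<in> X"
    using prefix by blast
  let ?x = "lift_seq (prepend (map f [0..<n]) y)"
  have top: "?x \<in> topspace ?T"
    using y sub lift_seq_in_topspace by blast
  have "?x i \<in> U i" for i
  proof (cases "i < n")
    case True
    then have "?x i = Some (f i)"
      by (simp add: lift_seq_prepend)
    then show ?thesis
      using U(1) by (auto simp: PiE_iff)
  next
    case False
    then have "U i = topspace (Alexandroff_compactification (discrete_topology A))"
      using n by blast
    then show ?thesis
      using top by (auto simp: compactified_product_def PiE_iff)
  qed
  then have "?x \<in> ?V"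
    using U(2) by (auto simp: PiE_iff)
  then show False
    using y by (simp add: truncate_lift_seq)
qed

text \<open>The preimage under truncation is the closed coordinate condition
  \<open>x 0 = None\<close>.\<close>

lemma closedin_full_shift_Nil:
  assumes "infinite A"
  shows "closedin (full_shift_topology A) {FinSeq []}"
proof -
  let ?T = "compactified_product A"
  have "truncate_seq x = FinSeq [] \<longleftrightarrow> x 0 = None" for x :: "nat \<Rightarrow> 'a option"
    by (auto simp: truncate_seq_def dest: LeastI)
  moreover have "closedin ?T {x \<in> topspace ?T. x 0 = None}"
    by (rule closedin_coordinate_eq) simp
  moreover have "{FinSeq []} \<subseteq> full_shift A"
    using assms by (auto simp: full_shift_def fin_seqs_def)
  ultimately show ?thesis
    using assms by (simp add: closedin_full_shift_iff)
qed

section \<open>Blocks and infinite extensions in a shift space\<close>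

lemma shift_space_prepend_suffix:
  assumes "shift_space A X" "prepend (u @ v) y \<in> X"
  shows "prepend v y \<in> X"
  using assms(2)
proof (induction u)
  case (Cons a u)
  have "shift_map (prepend (a # u @ v) y) = prepend (u @ v) y"
    by (cases y) auto
  then show ?case
    using Cons assms(1) by (auto simp: shift_space_def)
qed simp

text \<open>Shift invariance removes whatever precedes a block, so every block occurs at the start
  of some element.\<close>

lemma blocks_shift_space:
  assumes "shift_space A X"
  shows "u \<in> blocks X \<longleftrightarrow> (\<exists>z. prepend u z \<in> X)"
  unfolding blocks_def using shift_space_prepend_suffix[OF assms]
  by (auto intro: exI[of _ "[]"]) (metis append_Nil)

text \<open>If no infinite extension existed, the infinite-extension property would produce ever
  longer finite ones. Their common limit has all its prefixes extendable in \<open>X\<close>, so it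
  is an infinite extension after all.\<close>

lemma shift_space_InfSeq_extension:
  assumes "infinite A" and X: "shift_space A X" and "FinSeq u \<in> X"
  shows "\<exists>g. prepend u (InfSeq g) \<in> X"
proof (rule ccontr)
  assume no: "\<nexists>g. prepend u (InfSeq g) \<in> X"
  have step: "\<exists>v'. FinSeq (u @ v') \<in> X \<and> (\<exists>a w. v' = v @ a # w)"
    if "FinSeq (u @ v) \<in> X" for v
  proof -
    have "infinite {a \<in> A. \<exists>y\<in>full_shift A. prepend ((u @ v) @ [a]) y \<in> X}"
      using X that by (auto simp: shift_space_def infinite_extension_def)
    then obtain a y where ay: "prepend ((u @ v) @ [a]) y \<in> X"
      using not_finite_existsD by blast
    show ?thesis
    proof (cases y)
      case (FinSeq w)
      then show ?thesis using ay by auto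
    next
      \<comment> \<open>An infinite \<open>y\<close> would itself be an extension of the kind
        excluded by \<open>no\<close>.\<close>
      case (InfSeq g)
      have "prepend (v @ [a]) y = InfSeq (\<lambda>n. if n < length (v @ [a]) then (v @ [a]) ! n
          else g (n - length (v @ [a])))"
        by (simp only: InfSeq prepend.simps)
      then show ?thesis
        using ay no by (metis append.assoc prepend_append)
    qed
  qed
  obtain w where w: "\<And>n. FinSeq (u @ w n) \<in> X" "\<And>n. \<exists>a v. w (Suc n) = w n @ a # v"
    using dependent_nat_choice[of "\<lambda>_ v. FinSeq (u @ v) \<in> X" "\<lambda>_ v v'. \<exists>a t. v' = v @ a # t"]
      step assms(3) by (metis append.right_neutral)
  have len: "n \<le> length (w n)" for n
  proof (induction n)
    case (Suc n)
    then show ?case using w(2)[of n] by auto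
  qed simp
  have ext: "\<exists>t. w (n + k) = w n @ t" for n k
  proof (induction k)
    case (Suc k)
    then show ?case using w(2)[of "n + k"] by auto
  qed simp
  \<comment> \<open>The chain property makes each word a prefix of the later ones, and
    \<open>w (Suc n)\<close> has at least \<open>Suc n\<close> letters, so its entry
    \<open>n\<close> exists and never changes afterwards.\<close>
  define g where "g n = w (Suc n) ! n" for n
  have nth_w: "w n ! i = g i" if "i < n" for i n
  proof -
    from that have n: "Suc i + (n - Suc i) = n"
      by simp
    obtain t where "w n = w (Suc i) @ t"
      using ext[of "Suc i" "n - Suc i"] unfolding n by blast
    then show ?thesis
      using len[of "Suc i"] by (simp add: g_def nth_append)
  qed
  define f where "f n = (if n < length u then u ! n else g (n - length u))" for n
  have "InfSeq f \<in> X"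
  proof (rule closed_InfSeq_limit[OF assms(1)])
    show "closedin (full_shift_topology A) X"
      using X by (simp add: shift_space_def)
    fix n
    have "map f [0..<n] = take n (u @ w n)"
      using len[of n] by (intro nth_equalityI) (auto simp: f_def nth_append nth_w)
    then have "prepend (map f [0..<n]) (FinSeq (drop n (u @ w n))) = FinSeq (u @ w n)"
      by (simp only: prepend.simps append_take_drop_id)
    then show "\<exists>y. prepend (map f [0..<n]) y \<in> X"
      using w(1) by metis
  qed
  moreover have "prepend u (InfSeq g) = InfSeq f"
    by (simp add: f_def fun_eq_iff)
  ultimately show False
    using no by metis
qed

text \<open>A finite continuation after the letter \<open>a\<close> is replaced by an infinite one
  that keeps \<open>a\<close>, so no letter is lost.\<close>

lemma shift_space_infinite_InfSeq_extensions:
  assumes "infinite A" and X: "shift_space A X" and "FinSeq u \<in> X"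
  shows "infinite {a \<in> A. \<exists>g. prepend (u @ [a]) (InfSeq g) \<in> X}"
proof -
  have "infinite {a \<in> A. \<exists>y\<in>full_shift A. prepend (u @ [a]) y \<in> X}"
    using X assms(3) by (auto simp: shift_space_def infinite_extension_def)
  moreover have "\<exists>g. prepend (u @ [a]) (InfSeq g) \<in> X" if y: "prepend (u @ [a]) y \<in> X" for a y
  proof (cases y)
    case (FinSeq w)
    then obtain g where "prepend ((u @ [a]) @ w) (InfSeq g) \<in> X"
      using shift_space_InfSeq_extension[OF assms(1,2), of "(u @ [a]) @ w"] y by auto
    then show ?thesis
      by (metis prepend.simps(2) prepend_append)
  qed (use y in auto)
  ultimately show ?thesis
    by (elim contrapos_nn finite_subset[rotated]) blast
qed

section \<open>Equivalence of all conditions with the absence of nonempty finite sequences\<close>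

theorem proposition3p21:
  fixes A :: "'a set" and X :: "'a sequence set"
  assumes "shift_space A X"
  shows "(row_finite A X \<longleftrightarrow> fin_part A X \<subseteq> {FinSeq []}) \<and>
         (row_finite A X \<longleftrightarrow>
            closedin (full_shift_topology A) ((inf_part A X \<union> {FinSeq []}) \<inter> full_shift A)) \<and>
         (row_finite A X \<longleftrightarrow> X = inf_part A X \<union> {FinSeq []} \<or> finite_symbol X) \<and>
         (row_finite A X \<longleftrightarrow>
            (\<forall>a\<in>A. finite {b \<in> A. \<exists>x \<in> inf_part A X. prepend [a, b] x \<in> X}))"
proof (cases "finite A")
  \<comment> \<open>Over a finite alphabet there are no finite points, and all five conditions
    hold.\<close>
  case True
  have X: "X \<subseteq> inf_seqs A" "closedin (full_shift_topology A) X"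
    using assms True by (auto simp: shift_space_def full_shift_def)
  then have *: "fin_part A X = {}" "inf_part A X = X"
    by (auto simp: fin_part_def inf_part_def inf_seqs_def fin_seqs_def)
  have "(inf_part A X \<union> {FinSeq []}) \<inter> full_shift A = X"
    using X True by (auto simp: * full_shift_def inf_seqs_def)
  moreover have "{u \<in> blocks X. length u = 1} \<subseteq> (\<lambda>a. [a]) ` A"
  proof clarify
    fix u assume u: "u \<in> blocks X" "length u = 1"
    then obtain z where "prepend u z \<in> full_shift A"
      using blocks_shift_space[OF assms] assms by (auto simp: shift_space_def)
    then have "set u \<subseteq> A"
      by (rule prepend_in_full_shiftD)
    then show "u \<in> (\<lambda>a. [a]) ` A"
      using u(2) by (auto simp: length_Suc_conv)
  qed
  then have "finite_symbol X"
    unfolding finite_symbol_def using True by (blast intro: finite_subset)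
  ultimately show ?thesis
    using True X * by (simp add: row_finite_def)
next
  case False
  have cl: "closedin (full_shift_topology A) X" and sub: "X \<subseteq> full_shift A"
    using assms by (auto simp: shift_space_def)
  have nil: "FinSeq [] \<in> full_shift A"
    using False by (auto simp: full_shift_def fin_seqs_def)
  have split: "X = inf_part A X \<union> fin_part A X"
    using sub by (auto simp: full_shift_def inf_part_def fin_part_def split: if_splits)
  have in_fin_part: "FinSeq u \<in> fin_part A X" if "FinSeq u \<in> X" for u
    using that split by (auto simp: inf_part_def inf_seqs_def)
  have letters: "set u \<subseteq> A" if "prepend u y \<in> X" for u y
    using that sub prepend_in_full_shiftD by blast
  have inf_partI: "InfSeq g \<in> inf_part A X" if "InfSeq g \<in> X" for g
    using that split by (auto simp: fin_part_def fin_seqs_def)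
  \<comment> \<open>\<open>?fin\<close> is the hub: \<open>row_finite\<close> implies
    \<open>?rows\<close>, which implies \<open>?fin\<close>, which implies
    \<open>row_finite\<close>; the other two conditions are compared with \<open>?fin\<close>
    directly.\<close>
  let ?fin = "fin_part A X \<subseteq> {FinSeq []}"
  let ?Y = "(inf_part A X \<union> {FinSeq []}) \<inter> full_shift A"
  let ?rows = "\<forall>a\<in>A. finite {b \<in> A. \<exists>x \<in> inf_part A X. prepend [a, b] x \<in> X}"
  have row_imp: "?rows" if "row_finite A X"
  proof
    fix a assume "a \<in> A"
    then have "finite {b \<in> A. [a, b] \<in> blocks X}"
      using that by (simp add: row_finite_def)
    then show "finite {b \<in> A. \<exists>x \<in> inf_part A X. prepend [a, b] x \<in> X}"
      by (rule finite_subset[rotated]) (auto simp: blocks_shift_space[OF assms])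
  qed
  have rows_imp: "?fin" if rows: "?rows"
  proof
    fix s assume s: "s \<in> fin_part A X"
    then obtain u where u: "s = FinSeq u" "FinSeq u \<in> X"
      by (auto simp: fin_part_def fin_seqs_def)
    show "s \<in> {FinSeq []}"
    \<comment> \<open>By shift invariance the last letter \<open>a\<close> of \<open>u\<close> alone
      forms an element of \<open>X\<close>; its infinitely many successors contradict
      \<open>rows\<close>.\<close>
    proof (cases u rule: rev_cases)
      case (snoc v a)
      then have "FinSeq [a] \<in> X"
        using shift_space_prepend_suffix[OF assms, of v "[a]" "FinSeq []"] u by simp
      then have "infinite {b \<in> A. \<exists>g. prepend ([a] @ [b]) (InfSeq g) \<in> X}"
        by (rule shift_space_infinite_InfSeq_extensions[OF False assms])
      moreover have "InfSeq g \<in> inf_part A X" if "prepend ([a] @ [b]) (InfSeq g) \<in> X" for b g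
        using that shift_space_prepend_suffix[OF assms, of "[a, b]" "[]" "InfSeq g"]
        by (intro inf_partI) simp
      then have "{b \<in> A. \<exists>g. prepend ([a] @ [b]) (InfSeq g) \<in> X}
          \<subseteq> {b \<in> A. \<exists>x \<in> inf_part A X. prepend [a, b] x \<in> X}"
        by (auto simp del: prepend.simps)
      moreover have "a \<in> A"
        using letters[of "[a]" "FinSeq []"] \<open>FinSeq [a] \<in> X\<close> by simp
      ultimately show ?thesis
        using rows finite_subset by blast
    qed (simp add: u)
  qed
  have imp_row: "row_finite A X" if "?fin"
    unfolding row_finite_def
  proof (intro ballI, rule ccontr)
    fix a assume "infinite {b \<in> A. [a, b] \<in> blocks X}"
    then have "infinite {b. \<exists>y. prepend ([a] @ [b]) y \<in> X}"
      by (rule infinite_super[rotated]) (auto simp: blocks_shift_space[OF assms])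
    then have "FinSeq [a] \<in> X"
      by (rule closed_FinSeq_limit[OF False cl])
    then show False
      using that in_fin_part by blast
  qed
  have closed_iff: "closedin (full_shift_topology A) ?Y \<longleftrightarrow> ?fin"
  proof
    assume Y: "closedin (full_shift_topology A) ?Y"
    show ?fin
    proof
      fix s assume s: "s \<in> fin_part A X"
      then obtain u where u: "s = FinSeq u" "FinSeq u \<in> X"
        by (auto simp: fin_part_def fin_seqs_def)
      have "infinite {a \<in> A. \<exists>g. prepend (u @ [a]) (InfSeq g) \<in> X}"
        using u(2) by (rule shift_space_infinite_InfSeq_extensions[OF False assms])
      \<comment> \<open>Infinite elements of \<open>X\<close> stay in \<open>?Y\<close>, so the
        limit principle applies to \<open>?Y\<close> and puts \<open>u\<close> there; the only
        finite point of \<open>?Y\<close> is the empty sequence.\<close>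
      moreover have "prepend (u @ [a]) (InfSeq g) \<in> ?Y"
        if "prepend (u @ [a]) (InfSeq g) \<in> X" for a g
        using that sub inf_partI by auto
      ultimately have "infinite {a. \<exists>y. prepend (u @ [a]) y \<in> ?Y}"
        by (elim infinite_super[rotated]) (blast intro: infinite_super)
      then have "FinSeq u \<in> ?Y"
        by (rule closed_FinSeq_limit[OF False Y])
      then show "s \<in> {FinSeq []}"
        by (auto simp: u inf_part_def inf_seqs_def)
    qed
  next
    assume ?fin
    then have "?Y = X \<union> {FinSeq []}"
      using split sub nil by blast
    then show "closedin (full_shift_topology A) ?Y"
      using cl closedin_full_shift_Nil[OF False] by (simp only: closedin_Un)
  qed
  have symbol_iff: "X = inf_part A X \<union> {FinSeq []} \<or> finite_symbol X \<longleftrightarrow> ?fin"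
  proof (intro iffI; (elim disjE)?)
    assume X: "X = inf_part A X \<union> {FinSeq []}"
    show ?fin
    proof
      fix s assume s: "s \<in> fin_part A X"
      then have "s \<in> inf_part A X \<union> {FinSeq []}"
        using X by (auto simp: fin_part_def)
      with s show "s \<in> {FinSeq []}"
        by (auto simp: fin_part_def fin_seqs_def inf_part_def inf_seqs_def)
    qed
  next
    assume fs: "finite_symbol X"
    \<comment> \<open>Even the empty sequence is excluded: any finite element has infinitely many
      possible next letters, each of them a block of length 1.\<close>
    have "FinSeq u \<notin> X" for u
    proof
      assume "FinSeq u \<in> X"
      then have "infinite ((\<lambda>a. [a]) ` {a \<in> A. \<exists>y\<in>full_shift A. prepend (u @ [a]) y \<in> X})"
        using assms by (subst finite_image_iff)
          (auto simp: shift_space_def infinite_extension_def inj_on_def)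
      moreover have "(\<lambda>a. [a]) ` {a \<in> A. \<exists>y\<in>full_shift A. prepend (u @ [a]) y \<in> X}
          \<subseteq> {u \<in> blocks X. length u = 1}"
        by (auto simp: blocks_def)
      then have "finite ((\<lambda>a. [a]) ` {a \<in> A. \<exists>y\<in>full_shift A. prepend (u @ [a]) y \<in> X})"
        using fs unfolding finite_symbol_def by (rule finite_subset)
      ultimately show False
        by blast
    qed
    then show ?fin
      by (auto simp: fin_part_def fin_seqs_def)
  next
    assume ?fin
    show "X = inf_part A X \<union> {FinSeq []} \<or> finite_symbol X"
    proof (rule ccontr)
      assume neg: "\<not> ?thesis"
      \<comment> \<open>Infinitely many symbols can follow the empty word, so the limit principle
        for \<open>u = []\<close> gives \<open>FinSeq [] \<in> X\<close>; with \<open>?fin\<close>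
        this is the first alternative.\<close>
      have "{u \<in> blocks X. length u = 1} \<subseteq> (\<lambda>a. [a]) ` {a. \<exists>y. prepend ([] @ [a]) y \<in> X}"
        by (auto simp: blocks_shift_space[OF assms] length_Suc_conv)
      then have "infinite {a. \<exists>y. prepend ([] @ [a]) y \<in> X}"
        using neg finite_subset by (auto simp: finite_symbol_def)
      then have "FinSeq [] \<in> X"
        by (rule closed_FinSeq_limit[OF False cl])
      then show False
        using neg split in_fin_part \<open>?fin\<close> by blast
    qed
  qed
  show ?thesis
    using row_imp rows_imp imp_row closed_iff symbol_iff by blast
qed

end
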